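(* Consider either of the two models, very simple increasing trees or shape exchangeable trees. For each parameter $\alpha$ allowed in the model there exists a constant $c_\alpha>0$ such that, for the broadcasting process with bit-flipping probability $q$ on this tree model with parameter $\alpha$, for every $q\in[0,1]$, $$R_{\mathrm{maj}}(q)\le c_\alpha\sqrt q .$$
   Context: **Growing trees.** A growing random tree is a sequence $(T_n)_{n\ge 1}$ where $T_1$ is the single vertex $1$ (the root) and $T_{n+1}$ is obtained from $T_n$ by attaching the new vertex $n+1$ by one edge to a random vertex $v\in\{1,\dots,n\}$ (the parent of $n+1$), chosen according to a distribution depending only on $T_n$; write $n+1\sim v$ for this event. Let $\deg_n(v)$ be the degree of $v$ in $T_n$, and $\deg_n^+(v)$ its outdegree, i.e. the number of neighbours of $v$ in $T_n$ with a larger label (children). *Very simple increasing tree* with parameter $\alpha\in\{-1/d : d\in\mathbb N, d>1\}\cup[0,\infty)$: for all $v\in\{1,\dots,n\}$, $$\mathbb P(n+1\sim v\mid T_n)=\frac{\alpha\deg_n^+(v)+1}{\alpha(n-1)+n}.$$ *Shape exchangeable tree* with parameter $\alpha\in\{-1/d : d\in\mathbb N, d>2\}\cup[0,\infty)$: for all $v\in\{1,\dots,n\}$, $$\mathbb P(n+1\sim v\mid T_n)=\frac{\alpha\deg_n(v)+1}{2\alpha(n-1)+n}.$$ **Broadcasting process** with bit-flipping probability $q$: every vertex $u$ carries a color $B_u\in\{-1,1\}$. The root color $B_1$ is chosen uniformly at random. When vertex $n+1$ arrives, it first chooses its parent $p_{n+1}$ according to the attachment distribution given by $T_n$; then $B_{n+1}=B_{p_{n+1}}$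 with probability $1-q$ and $B_{n+1}=-B_{p_{n+1}}$ with probability $q$, independently of all other vertices and their colors. **Majority estimator**: $b_{\mathrm{maj}}(N,q)=\operatorname{sgn}\big(\sum_{u\in T_N}B_u\big)$ if $\sum_{u\in T_N}B_u\ne 0$, and otherwise $b_{\mathrm{maj}}(N,q)$ is an independent random variable that is uniform on $\{-1,1\}$. **Error probability**: $R_{\mathrm{maj}}(N,q)=\mathbb P(b_{\mathrm{maj}}(N,q)\ne B_1)$ and $R_{\mathrm{maj}}(q)=\limsup_{N\to\infty}R_{\mathrm{maj}}(N,q)$. *)

theory Defs
  imports "HOL-Probability.Probability"
begin

text \<open>
  A growing tree on the vertices \<open>1, \<dots>, n\<close> is represented by its set of undirected edges.
\<close>

type_synonym tree = "nat set set"

definition deg :: "tree \<Rightarrow> nat \<Rightarrow> nat" where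
  "deg T v = card {u. {u, v} \<in> T}"

definition outdeg :: "tree \<Rightarrow> nat \<Rightarrow> nat" where
  "outdeg T v = card {u. {u, v} \<in> T \<and> v < u}"

text \<open>
  An attachment rule maps the number \<open>n\<close> of vertices, the tree \<open>T\<^sub>n\<close> and a vertex \<open>v\<close> to
  the conditional probability that \<open>n + 1\<close> is attached to \<open>v\<close>.
\<close>

type_synonym attachment = "nat \<Rightarrow> tree \<Rightarrow> nat \<Rightarrow> real"

definition very_simple_params :: "real set" where
  "very_simple_params = {- 1 / real d | d :: nat. d > 1} \<union> {0..}"

definition very_simple :: "real \<Rightarrow> attachment" where
  "very_simple \<alpha> n T v =
     (\<alpha> * real (outdeg T v) + 1) / (\<alpha> * (real n - 1) + real n)"

definition shape_exchangeable_params :: "real set" where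
  "shape_exchangeable_params = {- 1 / real d | d :: nat. d > 2} \<union> {0..}"

definition shape_exchangeable :: "real \<Rightarrow> attachment" where
  "shape_exchangeable \<alpha> n T v =
     (\<alpha> * real (deg T v) + 1) / (2 * \<alpha> * (real n - 1) + real n)"

text \<open>
  \<open>embed_pmf\<close> is only meaningful for nonnegative weights of total mass 1. For the two models this
  holds at every tree that is reached with positive probability; see \<open>pmf_parent_very_simple\<close>
  and \<open>pmf_parent_shape_exchangeable\<close> below.
\<close>

definition parent_pmf :: "attachment \<Rightarrow> nat \<Rightarrow> tree \<Rightarrow> nat pmf" where
  "parent_pmf w n T = embed_pmf (\<lambda>v. if v \<in> {1..n} then w n T v else 0)"

definition uniform_sign :: "int pmf" where
  "uniform_sign = pmf_of_set {-1, 1}"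

text \<open>
  \<open>broadcast w q n\<close> is the joint law of the tree \<open>T\<^sub>n\<close> and the colors of its vertices. As the
  labels record the order of arrival, \<open>T\<^sub>n\<close> determines \<open>T\<^sub>1, \<dots>, T\<^sub>n\<close>. Colors of
  vertices that have not arrived yet are set to \<open>0\<close>, and the case \<open>n = 0\<close> is a dummy value.
\<close>

fun broadcast :: "attachment \<Rightarrow> real \<Rightarrow> nat \<Rightarrow> (tree \<times> (nat \<Rightarrow> int)) pmf" where
  "broadcast w q 0 = return_pmf ({}, \<lambda>_. 0)"
| "broadcast w q (Suc 0) =
     do {
       b \<leftarrow> uniform_sign;
       return_pmf ({}, (\<lambda>_. 0)(1 := b))
     }"
| "broadcast w q (Suc (Suc n)) =
     do {
       (T, B) \<leftarrow> broadcast w q (Suc n);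
       v \<leftarrow> parent_pmf w (Suc n) T;
       flip \<leftarrow> bernoulli_pmf q;
       return_pmf (insert {v, Suc (Suc n)} T,
                   B(Suc (Suc n) := (if flip then - B v else B v)))
     }"

text \<open>The joint law of the root color and the majority estimator.\<close>

definition root_and_majority :: "attachment \<Rightarrow> real \<Rightarrow> nat \<Rightarrow> (int \<times> int) pmf" where
  "root_and_majority w q N =
     do {
       (T, B) \<leftarrow> broadcast w q N;
       tie \<leftarrow> uniform_sign;
       let S = (\<Sum>u\<in>{1..N}. B u);
       return_pmf (B 1, if S \<noteq> 0 then sgn S else tie)
     }"

definition R_maj_at :: "attachment \<Rightarrow> nat \<Rightarrow> real \<Rightarrow> real" where
  "R_maj_at w N q = measure_pmf.prob (root_and_majority w q N) {(b, b_maj). b_maj \<noteq> b}"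

definition R_maj :: "attachment \<Rightarrow> real \<Rightarrow> ereal" where
  "R_maj w q = limsup (\<lambda>N. ereal (R_maj_at w N q))"


subsection \<open>The attachment probabilities are well-defined\<close>

definition grown :: "nat \<Rightarrow> tree \<Rightarrow> bool" where
  "grown n T \<longleftrightarrow> (\<forall>e\<in>T. e \<subseteq> {1..n}) \<and>
     (\<Sum>v\<in>{1..n}. outdeg T v) = n - 1 \<and> (\<Sum>v\<in>{1..n}. deg T v) = 2 * (n - 1)"

lemma grown_init: "grown (Suc 0) {}"
  by (simp add: grown_def outdeg_def deg_def)

lemma deg_outdeg_step:
  assumes "\<forall>e\<in>T. e \<subseteq> {1..n}" "v \<in> {1..n}"
  shows "x \<in> {1..n} \<Longrightarrow> outdeg (insert {v, Suc n} T) x = outdeg T x + (if x = v then 1 else 0)"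
    and "x \<in> {1..n} \<Longrightarrow> deg (insert {v, Suc n} T) x = deg T x + (if x = v then 1 else 0)"
    and "outdeg (insert {v, Suc n} T) (Suc n) = 0"
    and "deg (insert {v, Suc n} T) (Suc n) = 1"
proof -
  have fin: "finite {u. {u, x} \<in> T}" for x
    by (rule finite_subset[of _ "{1..n}"]) (use assms in auto)
  have new: "{Suc n, x} \<notin> T" "{x, Suc n} \<notin> T" for x
    using assms by fastforce+
  show "outdeg (insert {v, Suc n} T) x = outdeg T x + (if x = v then 1 else 0)" if "x \<in> {1..n}"
  proof -
    have "{u. {u, x} \<in> insert {v, Suc n} T \<and> x < u} =
        (if x = v then insert (Suc n) {u. {u, x} \<in> T \<and> x < u} else {u. {u, x} \<in> T \<and> x < u})"
      using that assms by (auto simp: doubleton_eq_iff)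
    moreover have "finite {u. {u, x} \<in> T \<and> x < u}"
      by (rule finite_subset[OF _ fin[of x]]) auto
    ultimately show ?thesis using new by (auto simp: outdeg_def)
  qed
  show "deg (insert {v, Suc n} T) x = deg T x + (if x = v then 1 else 0)" if "x \<in> {1..n}"
  proof -
    have "{u. {u, x} \<in> insert {v, Suc n} T} =
        (if x = v then insert (Suc n) {u. {u, x} \<in> T} else {u. {u, x} \<in> T})"
      using that assms by (auto simp: doubleton_eq_iff)
    then show ?thesis using new fin by (auto simp: deg_def)
  qed
  have "{u. {u, Suc n} \<in> insert {v, Suc n} T \<and> Suc n < u} = {}"
    using assms new by (auto simp: doubleton_eq_iff)
  then show "outdeg (insert {v, Suc n} T) (Suc n) = 0" by (simp only: outdeg_def card.empty)
  have "{u. {u, Suc n} \<in> insert {v, Suc n} T} = {v}"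
    using assms new by (auto simp: doubleton_eq_iff)
  then show "deg (insert {v, Suc n} T) (Suc n) = 1" by (simp add: deg_def)
qed

lemma grown_step:
  assumes "grown n T" "v \<in> {1..n}"
  shows "grown (Suc n) (insert {v, Suc n} T)"
proof -
  have e: "\<forall>e\<in>T. e \<subseteq> {1..n}" using assms by (simp add: grown_def)
  note st = deg_outdeg_step[OF e assms(2)]
  have "(\<Sum>x\<in>{1..n}. outdeg (insert {v, Suc n} T) x) = (n - 1) + 1"
    using assms st(1) by (simp add: grown_def sum.distrib)
  moreover have "(\<Sum>x\<in>{1..n}. deg (insert {v, Suc n} T) x) = 2 * (n - 1) + 1"
    using assms st(2) by (simp add: grown_def sum.distrib)
  moreover have "\<forall>e\<in>insert {v, Suc n} T. e \<subseteq> {1..Suc n}"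
    using e assms(2) by fastforce
  ultimately show ?thesis
    using assms(2) st(3,4) by (auto simp: grown_def)
qed

lemma pmf_parent:
  assumes "\<And>v. v \<in> {1..n} \<Longrightarrow> w n T v \<ge> 0" "(\<Sum>v\<in>{1..n}. w n T v) = 1"
  shows "pmf (parent_pmf w n T) v = (if v \<in> {1..n} then w n T v else 0)"
  unfolding parent_pmf_def
proof (rule pmf_embed_pmf)
  show "0 \<le> (if v \<in> {1..n} then w n T v else 0)" for v using assms(1) by auto
  have "(\<integral>\<^sup>+ v. ennreal (if v \<in> {1..n} then w n T v else 0) \<partial>count_space UNIV)
      = (\<integral>\<^sup>+ v. ennreal (w n T v) * indicator {1..n} v \<partial>count_space UNIV)"
    by (rule nn_integral_cong) auto
  also have "\<dots> = (\<integral>\<^sup>+ v. ennreal (w n T v) \<partial>count_space {1..n})"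
    by (simp add: nn_integral_count_space_indicator)
  also have "\<dots> = (\<Sum>v\<in>{1..n}. ennreal (w n T v))"
    by (simp add: nn_integral_count_space_finite)
  also have "\<dots> = ennreal (\<Sum>v\<in>{1..n}. w n T v)"
    using assms(1) by (rule sum_ennreal)
  finally show "(\<integral>\<^sup>+ v. ennreal (if v \<in> {1..n} then w n T v else 0) \<partial>count_space UNIV) = 1"
    using assms(2) by simp
qed

lemma set_broadcast_induct:
  assumes "(T, B) \<in> set_pmf (broadcast w q n)" "n \<ge> 1"
    and "P 1 {}"
    and "\<And>n T v. n \<ge> 1 \<Longrightarrow> P n T \<Longrightarrow> v \<in> set_pmf (parent_pmf w n T) \<Longrightarrow>
           P (Suc n) (insert {v, Suc n} T)"
  shows "P n T"
  using assms(2,1)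
proof (induction n arbitrary: T B rule: nat_induct_at_least)
  case base
  then show ?case using assms(3) by auto
next
  case (Suc n)
  then obtain m where m: "n = Suc m" by (cases n) auto
  from Suc.prems[unfolded m] obtain T' B' v where
    "(T', B') \<in> set_pmf (broadcast w q n)" "v \<in> set_pmf (parent_pmf w n T')"
    "T = insert {v, Suc n} T'"
    by (auto simp: m)
  with Suc.IH Suc.hyps assms(4) show ?case by blast
qed

lemma parent_weights:
  assumes "\<And>v. w n T v = (\<alpha> * real (f v) + 1) / (\<alpha> * s + real n)"
    and "(\<Sum>v\<in>{1..n}. real (f v)) = s" "\<alpha> * s + real n > 0"
    and "\<And>v. v \<in> {1..n} \<Longrightarrow> \<alpha> * real (f v) + 1 \<ge> 0"
  shows "pmf (parent_pmf w n T) v = (if v \<in> {1..n} then w n T v else 0)"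
proof (rule pmf_parent)
  show "w n T v \<ge> 0" if "v \<in> {1..n}" for v
    using assms(1,3,4) that by simp
  have "(\<Sum>v\<in>{1..n}. w n T v) = (\<alpha> * s + real n) / (\<alpha> * s + real n)"
    by (simp add: assms(1) flip: assms(2) sum_divide_distrib)
       (simp add: sum.distrib sum_distrib_left)
  then show "(\<Sum>v\<in>{1..n}. w n T v) = 1" using assms(3) by simp
qed

text \<open>For \<open>\<alpha> = - 1 / d\<close>, a vertex of (out)degree \<open>d\<close> receives no further children.\<close>

lemma weight_step:
  assumes "\<alpha> \<in> {- 1 / real d | d :: nat. d > k} \<union> {0..}" "\<alpha> * real m + 1 > 0"
  shows "\<alpha> * real (Suc m) + 1 \<ge> 0"
  using assms(1)
proof
  assume "\<alpha> \<in> {- 1 / real d | d :: nat. d > k}"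
  then obtain d where d: "\<alpha> = - 1 / real d" "d > 0" by auto
  with assms(2) have "real m < real d" by (simp add: field_simps)
  then have "real (Suc m) \<le> real d" by simp
  then have "real (Suc m) / real d \<le> 1" using d by (subst divide_le_eq_1_pos) auto
  then show ?thesis unfolding d(1) by simp
qed auto

lemma denominator_pos:
  assumes "\<alpha> \<in> {- 1 / real d | d :: nat. d > k} \<union> {0..}" "n \<ge> 1" "k \<ge> 1"
  shows "\<alpha> * (real k * (real n - 1)) + real n > 0"
  using assms(1)
proof
  assume "\<alpha> \<in> {- 1 / real d | d :: nat. d > k}"
  then obtain d where d: "\<alpha> = - 1 / real d" "d > k" by auto
  have "real k * (real n - 1) \<le> real d * (real n - 1)"
    using d assms(2) by (intro mult_right_mono) auto
  then have "real k * (real n - 1) / real d \<le> real n - 1"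
    using d by (simp add: pos_divide_le_eq mult.commute)
  moreover have "\<alpha> * (real k * (real n - 1)) = - (real k * (real n - 1) / real d)"
    unfolding d(1) by simp
  ultimately show ?thesis by linarith
next
  assume "\<alpha> \<in> {0..}"
  then show ?thesis using assms(2) by (simp add: add_nonneg_pos)
qed

lemma pmf_parent_very_simple:
  assumes "\<alpha> \<in> very_simple_params" "n \<ge> 1"
    and "(T, B) \<in> set_pmf (broadcast (very_simple \<alpha>) q n)"
  shows "pmf (parent_pmf (very_simple \<alpha>) n T) v =
           (if v \<in> {1..n} then very_simple \<alpha> n T v else 0)"
proof -
  let ?P = "\<lambda>n T. grown n T \<and> (\<forall>v\<in>{1..n}. \<alpha> * real (outdeg T v) + 1 \<ge> 0)"
  have \<alpha>: "\<alpha> \<in> {- 1 / real d | d :: nat. d > 1} \<union> {0..}"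
    using assms(1) by (simp add: very_simple_params_def)
  have pmf: "pmf (parent_pmf (very_simple \<alpha>) n T) v =
      (if v \<in> {1..n} then very_simple \<alpha> n T v else 0)" if "n \<ge> 1" "?P n T" for n T v
    using that denominator_pos[OF \<alpha> that(1)]
    by (intro parent_weights[of _ _ _ \<alpha> "outdeg T" "real n - 1"])
       (auto simp: very_simple_def grown_def simp flip: of_nat_sum)
  have "?P n T"
    using assms(3,2)
  proof (rule set_broadcast_induct)
    fix n T v assume *: "n \<ge> 1" "?P n T" "v \<in> set_pmf (parent_pmf (very_simple \<alpha>) n T)"
    then have v: "v \<in> {1..n}" "very_simple \<alpha> n T v \<noteq> 0"
      using pmf by (auto simp: set_pmf_iff split: if_splits)
    then have "\<alpha> * real (outdeg T v) + 1 > 0"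
      using * by (force simp: very_simple_def less_le)
    then have "\<alpha> * (real (outdeg T v) + 1) + 1 \<ge> 0"
      using weight_step[OF \<alpha>] by (simp add: add.commute)
    then show "?P (Suc n) (insert {v, Suc n} T)"
      using * v grown_step[of n T v] deg_outdeg_step[of T n v]
      by (auto simp: grown_def le_Suc_eq add.commute)
  qed (auto simp: grown_init outdeg_def)
  with pmf assms(2) show ?thesis by blast
qed

lemma pmf_parent_shape_exchangeable:
  assumes "\<alpha> \<in> shape_exchangeable_params" "n \<ge> 1"
    and "(T, B) \<in> set_pmf (broadcast (shape_exchangeable \<alpha>) q n)"
  shows "pmf (parent_pmf (shape_exchangeable \<alpha>) n T) v =
           (if v \<in> {1..n} then shape_exchangeable \<alpha> n T v else 0)"
proof -
  let ?P = "\<lambda>n T. grown n T \<and> (\<forall>v\<in>{1..n}. \<alpha> * real (deg T v) + 1 \<ge> 0)"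
  have \<alpha>: "\<alpha> \<in> {- 1 / real d | d :: nat. d > 2} \<union> {0..}"
    using assms(1) by (simp add: shape_exchangeable_params_def)
  have pmf: "pmf (parent_pmf (shape_exchangeable \<alpha>) n T) v =
      (if v \<in> {1..n} then shape_exchangeable \<alpha> n T v else 0)" if "n \<ge> 1" "?P n T" for n T v
    using that denominator_pos[OF \<alpha> that(1)]
    by (intro parent_weights[of _ _ _ \<alpha> "deg T" "2 * (real n - 1)"])
       (auto simp: shape_exchangeable_def grown_def algebra_simps simp flip: of_nat_sum)
  have "- 1 \<le> \<alpha>"
    using \<alpha> by (auto simp: field_simps)
  have "?P n T"
    using assms(3,2)
  proof (rule set_broadcast_induct)
    fix n T v assume *: "n \<ge> 1" "?P n T" "v \<in> set_pmf (parent_pmf (shape_exchangeable \<alpha>) n T)"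
    then have v: "v \<in> {1..n}" "shape_exchangeable \<alpha> n T v \<noteq> 0"
      using pmf by (auto simp: set_pmf_iff split: if_splits)
    then have "\<alpha> * real (deg T v) + 1 > 0"
      using * by (force simp: shape_exchangeable_def less_le)
    then have "\<alpha> * (real (deg T v) + 1) + 1 \<ge> 0"
      using weight_step[OF \<alpha>] by (simp add: add.commute)
    then show "?P (Suc n) (insert {v, Suc n} T)"
      using * v grown_step[of n T v] deg_outdeg_step[of T n v] \<open>- 1 \<le> \<alpha>\<close>
      by (auto simp: grown_def le_Suc_eq add.commute)
  qed (auto simp: grown_init deg_def)
  with pmf assms(2) show ?thesis by blast
qed

end

theory Submission
  imports Defs "HOL-Real_Asymp.Real_Asymp"
begin

text \<open>
  In both models the attractiveness of a vertex is an affine function of its degree, and a new leaf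
  raises the total attractiveness by a constant \<open>\<gamma>\<close>. Multiply all colors by the color of the root;
  the root is then always \<open>1\<close>. Two quantities suffice: the sum \<open>S\<^sub>n\<close> of the signed colors and the
  sum \<open>W\<^sub>n\<close> of the signed colors weighted by attractiveness. Their joint evolution is a Markov chain
  (\<open>moment_Suc\<close>), because the next parent has color \<open>1\<close> with probability \<open>(1 + W\<^sub>n / D\<^sub>n) / 2\<close>,
  where \<open>D\<^sub>n\<close> is the total attractiveness. The majority errs only if \<open>S\<^sub>n \<le> 0\<close>.

  The recursions for the first two moments of \<open>W\<^sub>n\<close> are linear. The mean \<open>m\<^sub>n\<close> gains the factor
  \<open>1 + \<rho> / D\<^sub>n\<close>, where \<open>\<rho>\<close> differs from \<open>\<gamma>\<close> by a multiple of \<open>q\<close>. For \<open>q = 0\<close> one has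
  \<open>W\<^sub>n = D\<^sub>n\<close> with no variance at all, and the limit of \<open>Var W\<^sub>n / m\<^sub>n\<^sup>2\<close> stays of order \<open>q\<close>
  when the recursion is perturbed (\<open>second_moment_bound\<close>, \<open>limiting_variance_bound\<close>).

  For a suitable \<open>\<theta>\<close> the difference \<open>S\<^sub>n - \<theta> W\<^sub>n\<close> is a martingale with bounded increments, so its
  second moment grows only linearly (\<open>residual_Suc\<close>). For small \<open>q\<close> the exponent \<open>\<rho> / \<gamma>\<close> of the
  growth of \<open>m\<^sub>n\<close> exceeds one half, hence \<open>m\<^sub>n\<^sup>2\<close> outgrows \<open>n\<close> (\<open>mean_growth\<close>) and the
  difference is negligible: \<open>S\<^sub>n\<close> behaves like \<open>\<theta> W\<^sub>n\<close>. Chebyshev's inequality bounds the limiting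
  error by a multiple of \<open>q\<close>, which is at most the same multiple of \<open>sqrt q\<close>. For \<open>q\<close> bounded
  away from \<open>0\<close> it is enough that probabilities are at most \<open>1\<close>.
\<close>

section \<open>Auxiliary facts on finite expectations and real inequalities\<close>

lemma expectation_bind_finite:
  fixes h :: "'b \<Rightarrow> real"
  assumes "finite (set_pmf p)" "\<And>x. x \<in> set_pmf p \<Longrightarrow> finite (set_pmf (k x))"
  shows "measure_pmf.expectation (p \<bind> k) h =
         measure_pmf.expectation p (\<lambda>x. measure_pmf.expectation (k x) h)"
  using assms
  by (simp add: pmf_expectation_bind[of "set_pmf p"] integral_measure_pmf[of "set_pmf p"])

lemma expectation_cong_pmf:
  fixes g h :: "'a \<Rightarrow> real"
  assumes "\<And>x. x \<in> set_pmf p \<Longrightarrow> g x = h x"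
  shows "measure_pmf.expectation p g = measure_pmf.expectation p h"
  using assms by (intro integral_cong_AE) (auto simp: AE_measure_pmf_iff)

lemma square_sum_le: "(u + v)\<^sup>2 \<le> 2 * u\<^sup>2 + 2 * v\<^sup>2" for u v :: real
  using zero_le_power2[of "u - v"] by (simp add: power2_sum power2_diff)

text \<open>
  The expected square of \<open>z\<close> after one step of the chain: with \<open>p\<close> the mean of the parent's color, a
  faithful copy moves \<open>z\<close> by \<open>c\<close> in the direction of that color, a flipped one by \<open>d\<close> against it.
  Since the colors are signs, \<open>p\<close> survives only in the cross term.
\<close>

lemma two_sided_square:
  fixes p q z c d :: real
  shows "(1 + p) / 2 * ((1 - q) * (z + c)\<^sup>2 + q * (z - d)\<^sup>2) +
         (1 - p) / 2 * ((1 - q) * (z - c)\<^sup>2 + q * (z + d)\<^sup>2) =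
         z\<^sup>2 + ((1 - q) * c\<^sup>2 + q * d\<^sup>2) + 2 * z * p * ((1 - q) * c - q * d)"
proof -
  define M where "M = z\<^sup>2 + ((1 - q) * c\<^sup>2 + q * d\<^sup>2)"
  define N where "N = 2 * z * ((1 - q) * c - q * d)"
  have "(1 - q) * (z + c)\<^sup>2 + q * (z - d)\<^sup>2 = M + N" "(1 - q) * (z - c)\<^sup>2 + q * (z + d)\<^sup>2 = M - N"
    unfolding M_def N_def by (simp_all add: power2_eq_square algebra_simps)
  moreover have "(1 + p) / 2 * (M + N) + (1 - p) / 2 * (M - N) = M + p * N"
    by (simp add: field_simps)
  ultimately show ?thesis by (simp add: M_def N_def)
qed


text \<open>
  Every function on \<open>{- 1, 1}\<close> is affine. This is why the weighted sum of the colors determines the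
  law of the parent's color.
\<close>

lemma affine_interpolation:
  fixes u v r :: real
  shows "r * u = (u + v) / 2 * r + (u - v) / 2 * r"
    and "r * v = (u + v) / 2 * r + (u - v) / 2 * (- r)"
    and "(u + v) / 2 + (u - v) / 2 * r = (1 + r) / 2 * u + (1 - r) / 2 * v"
  by (simp_all add: field_simps)

text \<open>
  The factor \<open>(1 + 2 * \<rho> / D) / (1 + \<rho> / D)\<^sup>2\<close> by which a normalized second moment shrinks is bounded
  by a telescoping quotient. For \<open>\<rho> = \<gamma>\<close> this is an equality; the value \<open>x = \<rho>\<^sup>2 / \<gamma>\<close> is the one
  that makes the terms of order \<open>D\<close> cancel, and what remains is \<open>x * (\<gamma> - \<rho>)\<^sup>2 \<ge> 0\<close>.
\<close>

lemma ratio_step: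
  fixes \<gamma> \<rho> D :: real
  assumes "\<gamma> > 0" "D > 0"
  defines "x \<equiv> \<rho>\<^sup>2 / \<gamma>"
  shows "(1 + x / D) * (1 + 2 * \<rho> / D) \<le> (1 + x / (D + \<gamma>)) * (1 + \<rho> / D)\<^sup>2"
proof -
  have x: "\<gamma> * x = \<rho>\<^sup>2" "x \<ge> 0" using assms by auto
  have "(D + \<gamma> + x) * (D + \<rho>)\<^sup>2 - (D + x) * (D + 2 * \<rho>) * (D + \<gamma>)
      = D * (\<rho>\<^sup>2 - \<gamma> * x) + (\<gamma> + x) * \<rho>\<^sup>2 - 2 * \<rho> * (\<gamma> * x)"
    by (simp add: power2_eq_square algebra_simps)
  also have "\<dots> = x * (\<gamma> * \<gamma> + \<gamma> * x - 2 * \<rho> * \<gamma>)"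
    unfolding x(1)[symmetric] by (simp add: algebra_simps)
  also have "\<dots> = x * (\<gamma> - \<rho>)\<^sup>2"
    unfolding x(1) by (simp add: power2_eq_square algebra_simps)
  also have "\<dots> \<ge> 0" using x(2) by simp
  finally have "(D + x) * (D + 2 * \<rho>) * (D + \<gamma>) \<le> (D + \<gamma> + x) * (D + \<rho>)\<^sup>2"
    by simp
  then have "(D + x) * (D + 2 * \<rho>) * (D + \<gamma>) / (D * D * (D + \<gamma>))
           \<le> (D + \<gamma> + x) * (D + \<rho>)\<^sup>2 / (D * D * (D + \<gamma>))"
    using assms by (intro divide_right_mono) auto
  moreover have "1 + x / D = (D + x) / D" "1 + 2 * \<rho> / D = (D + 2 * \<rho>) / D"
    "1 + x / (D + \<gamma>) = (D + \<gamma> + x) / (D + \<gamma>)" "1 + \<rho> / D = (D + \<rho>) / D"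
    using assms by (simp_all add: add_divide_distrib)
  ultimately show ?thesis
    using assms by (simp add: power_divide power2_eq_square[of D] mult_ac)
qed

text \<open>
  A version with integer exponents of \<open>(1 + t) powr (3 / 4) \<le> 1 + 3 / 4 * t\<close>.
\<close>

lemma cube_le_fourth_power:
  fixes t s :: real
  assumes "t \<ge> 0" "s \<ge> 3 / 4 * t"
  shows "(1 + t) ^ 3 \<le> (1 + s) ^ 4"
proof -
  define u where "u = t / 4"
  have t: "t = 4 * u" and u: "u \<ge> 0" using assms(1) by (simp_all add: u_def)
  have "(1 + 3 * u) ^ 4 - (1 + 4 * u) ^ 3 = u * u * (6 + 44 * u + 81 * (u * u))"
    by (simp add: power_numeral_reduce algebra_simps)
  also have "\<dots> \<ge> 0" using u by simp
  finally have "(1 + t) ^ 3 \<le> (1 + 3 / 4 * t) ^ 4" by (simp add: t)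
  also have "\<dots> \<le> (1 + s) ^ 4" using assms by (intro power_mono) auto
  finally show ?thesis .
qed

section \<open>Attachment with affine weights\<close>

text \<open>
  Both models at once: \<open>f\<close> is the outdegree or the degree, and \<open>e\<close> is its value \<open>0\<close> or \<open>1\<close> at a new
  leaf. The denominator is the total weight, as the root starts with weight \<open>1\<close> and each step adds
  \<open>\<alpha>\<close> at the parent and \<open>1 + \<alpha> * e\<close> at the new leaf.
\<close>

locale linear_attachment =
  fixes w :: attachment and \<alpha> :: real and f :: "tree \<Rightarrow> nat \<Rightarrow> nat" and e :: nat and q :: real
  assumes q_range: "0 \<le> q" "q \<le> 1"
    and f_init: "f {} 1 = 0"
    and f_old: "\<lbrakk>\<forall>e\<in>T. e \<subseteq> {1..n}; v \<in> {1..n}; u \<in> {1..n}\<rbrakk> \<Longrightarrow>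
           f (insert {v, Suc n} T) u = f T u + (if u = v then 1 else 0)"
    and f_new: "\<lbrakk>\<forall>e\<in>T. e \<subseteq> {1..n}; v \<in> {1..n}\<rbrakk> \<Longrightarrow> f (insert {v, Suc n} T) (Suc n) = e"
    and pmf_attach: "\<lbrakk>n \<ge> 1; (T, B) \<in> set_pmf (broadcast w q n)\<rbrakk> \<Longrightarrow>
           pmf (parent_pmf w n T) v =
             (if v \<in> {1..n}
              then (\<alpha> * real (f T v) + 1) / (1 + (\<alpha> + (1 + \<alpha> * real e)) * (real n - 1)) else 0)"
    and leaf_weight_pos: "1 + \<alpha> * real e > 0"
    and growth_pos: "\<alpha> + (1 + \<alpha> * real e) > 0"
begin

definition a :: real where "a = 1 + \<alpha> * real e"

definition \<gamma> :: real where "\<gamma> = \<alpha> + a"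

text \<open>
  The expected increment of the signed weight in units of the mean color of the parent: the parent
  gains \<open>\<alpha>\<close>, and the child contributes \<open>a\<close> times \<open>1 - 2 * q\<close>.
\<close>

definition \<rho> :: real where "\<rho> = \<gamma> - 2 * a * q"

definition total_weight :: "nat \<Rightarrow> real" where "total_weight n = 1 + \<gamma> * (real n - 1)"

definition weight :: "tree \<Rightarrow> nat \<Rightarrow> real" where "weight T v = \<alpha> * real (f T v) + 1"

definition signed_weight :: "nat \<Rightarrow> tree \<Rightarrow> (nat \<Rightarrow> int) \<Rightarrow> real" where
  "signed_weight n T B = (\<Sum>v\<in>{1..n}. real_of_int (B 1 * B v) * weight T v)"

definition signed_size :: "nat \<Rightarrow> (nat \<Rightarrow> int) \<Rightarrow> real" where
  "signed_size n B = (\<Sum>v\<in>{1..n}. real_of_int (B 1 * B v))"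

definition moment :: "nat \<Rightarrow> (real \<Rightarrow> real \<Rightarrow> real) \<Rightarrow> real" where
  "moment n g = measure_pmf.expectation (broadcast w q n)
     (\<lambda>(T, B). g (signed_weight n T B) (signed_size n B))"

lemma a_pos: "a > 0" and \<gamma>_pos: "\<gamma> > 0"
  using leaf_weight_pos growth_pos by (auto simp: a_def \<gamma>_def)

lemma pmf_parent_weight:
  assumes "n \<ge> 1" "(T, B) \<in> set_pmf (broadcast w q n)"
  shows "pmf (parent_pmf w n T) v = (if v \<in> {1..n} then weight T v / total_weight n else 0)"
  using pmf_attach[OF assms] by (simp add: weight_def total_weight_def a_def \<gamma>_def)

lemma set_parent_pmf:
  assumes "n \<ge> 1" "(T, B) \<in> set_pmf (broadcast w q n)"
  shows "set_pmf (parent_pmf w n T) \<subseteq> {1..n}"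
  using pmf_parent_weight[OF assms] by (auto simp: set_pmf_iff split: if_splits)

lemma broadcast_Suc:
  assumes "n \<ge> 1"
  shows "broadcast w q (Suc n) = broadcast w q n \<bind> (\<lambda>(T, B).
           parent_pmf w n T \<bind> (\<lambda>v. bernoulli_pmf q \<bind> (\<lambda>flip.
             return_pmf (insert {v, Suc n} T,
                         B(Suc n := (if flip then - B v else B v))))))"
  using assms by (cases n) auto

text \<open>
  That the vertices are \<open>1, \<dots>, n\<close> is needed for the degree updates, that the colors are signs for
  the affine interpolation.
\<close>

lemma broadcast_support:
  assumes "n \<ge> 1" "(T, B) \<in> set_pmf (broadcast w q n)"
  shows "(\<forall>e\<in>T. e \<subseteq> {1..n}) \<and> (\<forall>v\<in>{1..n}. B v \<in> {-1, 1})"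
  using assms
proof (induction n arbitrary: T B rule: nat_induct_at_least)
  case base
  then show ?case by (auto simp: uniform_sign_def)
next
  case (Suc n)
  from Suc.prems obtain T' B' v b where *: "(T', B') \<in> set_pmf (broadcast w q n)"
    "v \<in> set_pmf (parent_pmf w n T')" "T = insert {v, Suc n} T'"
    "B = B'(Suc n := (if b then - B' v else B' v))"
    unfolding broadcast_Suc[OF Suc.hyps] by fastforce
  have v: "v \<in> {1..n}" using set_parent_pmf[OF Suc.hyps *(1)] *(2) by auto
  note IH = conjunct1[OF Suc.IH[OF *(1)]] conjunct2[OF Suc.IH[OF *(1)]]
  have "e \<subseteq> {1..Suc n}" if "e \<in> T" for e
  proof (cases "e = {v, Suc n}")
    case True
    then show ?thesis using v by simp
  next
    case False
    then have "e \<subseteq> {1..n}" using that IH(1) unfolding *(3) by simp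
    also have "\<dots> \<subseteq> {1..Suc n}" by simp
    finally show ?thesis .
  qed
  moreover have "B u \<in> {-1, 1}" if "u \<in> {1..Suc n}" for u
  proof (cases "u = Suc n")
    case True
    then show ?thesis using bspec[OF IH(2) v] unfolding *(4) by (cases b) auto
  next
    case False
    then have "u \<in> {1..n}" using that by auto
    then show ?thesis using bspec[OF IH(2)] False unfolding *(4) by simp
  qed
  ultimately show ?case by blast
qed

lemma finite_broadcast: "finite (set_pmf (broadcast w q (Suc n)))"
proof (induction n)
  case 0
  then show ?case by (simp add: uniform_sign_def)
next
  case (Suc n)
  have "finite (set_pmf (parent_pmf w (Suc n) T))"
    if "(T, B) \<in> set_pmf (broadcast w q (Suc n))" for T B
    using set_parent_pmf[OF _ that] finite_subset by auto
  then show ?case using Suc by (subst broadcast_Suc) (auto simp del: broadcast.simps)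
qed

text \<open>Here \<open>s\<close> is \<open>1\<close> for a faithful copy and \<open>- 1\<close> for a flip.\<close>

lemma signed_step:
  assumes "n \<ge> 1" "(T, B) \<in> set_pmf (broadcast w q n)" "v \<in> {1..n}"
  shows "signed_weight (Suc n) (insert {v, Suc n} T) (B(Suc n := s * B v)) =
           signed_weight n T B + (\<alpha> + a * real_of_int s) * real_of_int (B 1 * B v)"
    and "signed_size (Suc n) (B(Suc n := s * B v)) =
           signed_size n B + real_of_int s * real_of_int (B 1 * B v)"
proof -
  have T: "\<forall>e\<in>T. e \<subseteq> {1..n}" using broadcast_support[OF assms(1,2)] by simp
  let ?T = "insert {v, Suc n} T" and ?B = "B(Suc n := s * B v)"
  have old: "weight ?T u = weight T u + (if u = v then \<alpha> else 0)" if "u \<in> {1..n}" for u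
    using f_old[OF T assms(3) that] by (simp add: weight_def algebra_simps)
  have new: "weight ?T (Suc n) = a"
    using f_new[OF T assms(3)] by (simp add: weight_def a_def)
  have B1: "?B 1 = B 1" using assms(1) by simp
  have "(\<Sum>u\<in>{1..n}. real_of_int (?B 1 * ?B u) * weight ?T u) =
        (\<Sum>u\<in>{1..n}. real_of_int (B 1 * B u) * weight T u
                     + (if u = v then \<alpha> * real_of_int (B 1 * B v) else 0))"
    by (intro sum.cong refl, simp only: old B1) (auto simp: algebra_simps)
  also have "\<dots> = signed_weight n T B + \<alpha> * real_of_int (B 1 * B v)"
    using assms(3) by (simp add: sum.distrib signed_weight_def)
  finally show "signed_weight (Suc n) ?T ?B =
           signed_weight n T B + (\<alpha> + a * real_of_int s) * real_of_int (B 1 * B v)"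
    using assms(1) new by (simp add: signed_weight_def algebra_simps)
  show "signed_size (Suc n) ?B = signed_size n B + real_of_int s * real_of_int (B 1 * B v)"
    using assms(1) by (simp add: signed_size_def algebra_simps)
qed

section \<open>The Markov chain of signed weight and signed size\<close>

text \<open>
  Given the tree and the colors, the new pair depends on the parent only through its signed color
  \<open>\<beta>\<close>. The parent is drawn in proportion to its weight, so the expectation of \<open>\<beta>\<close> is \<open>x / D\<close>; by
  interpolation this determines the expectation of any function of \<open>\<beta>\<close>.
\<close>

lemma moment_Suc:
  assumes "n \<ge> 1"
  defines "D \<equiv> total_weight n"
  shows "moment (Suc n) g = moment n (\<lambda>x y.
           (1 + x / D) / 2 * ((1 - q) * g (x + \<gamma>) (y + 1) + q * g (x + (\<alpha> - a)) (y - 1)) +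
           (1 - x / D) / 2 * ((1 - q) * g (x - \<gamma>) (y - 1) + q * g (x - (\<alpha> - a)) (y + 1)))"
proof -
  define G where "G = (\<lambda>(T, B). g (signed_weight (Suc n) T B) (signed_size (Suc n) B))"
  define K where "K = (\<lambda>(T, B :: nat \<Rightarrow> int). parent_pmf w n T \<bind> (\<lambda>v. bernoulli_pmf q \<bind> (\<lambda>flip.
             return_pmf (insert {v, Suc n} T, B(Suc n := (if flip then - B v else B v))))))"
  have fin: "finite (set_pmf (broadcast w q n))"
    using finite_broadcast[of "n - 1"] assms(1) by simp
  have finp: "finite (set_pmf (parent_pmf w n T))"
    if "(T, B) \<in> set_pmf (broadcast w q n)" for T B
    using set_parent_pmf[OF assms(1) that] finite_subset by auto
  have "moment (Suc n) g = measure_pmf.expectation (broadcast w q n \<bind> K) G"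
    using assms(1) by (simp only: moment_def broadcast_Suc G_def K_def)
  also have "\<dots> = measure_pmf.expectation (broadcast w q n)
                    (\<lambda>x. measure_pmf.expectation (K x) G)"
    using fin finp by (intro expectation_bind_finite) (auto simp: K_def)
  also have "\<dots> = moment n (\<lambda>x y.
           (1 + x / D) / 2 * ((1 - q) * g (x + \<gamma>) (y + 1) + q * g (x + (\<alpha> - a)) (y - 1)) +
           (1 - x / D) / 2 * ((1 - q) * g (x - \<gamma>) (y - 1) + q * g (x - (\<alpha> - a)) (y + 1)))"
    unfolding moment_def
  proof (intro expectation_cong_pmf, clarify)
    fix T B assume TB: "(T, B) \<in> set_pmf (broadcast w q n)"
    define x where "x = signed_weight n T B"
    define y where "y = signed_size n B"
    \<comment> \<open>the average over the flip, as a function of the parent's signed color\<close>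
    define h where "h = (\<lambda>\<beta>. (1 - q) * g (x + \<gamma> * \<beta>) (y + \<beta>) + q * g (x + (\<alpha> - a) * \<beta>) (y - \<beta>))"
    have h1: "h 1 = (1 - q) * g (x + \<gamma>) (y + 1) + q * g (x + (\<alpha> - a)) (y - 1)"
      by (simp add: h_def)
    have "x + \<gamma> * - 1 = x - \<gamma>" "x + (\<alpha> - a) * - 1 = x - (\<alpha> - a)" "y + - 1 = y - 1" "y - - 1 = y + 1"
      by simp_all
    then have hm1: "h (- 1) = (1 - q) * g (x - \<gamma>) (y - 1) + q * g (x - (\<alpha> - a)) (y + 1)"
      by (simp only: h_def)
    define \<beta> where "\<beta> = (\<lambda>v. real_of_int (B 1 * B v))"
    have sum1: "(\<Sum>v\<in>{1..n}. weight T v / D) = 1"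
      using sum_pmf_eq_1[OF _ set_parent_pmf[OF assms(1) TB]] pmf_parent_weight[OF assms(1) TB]
      by (simp add: D_def)
    have flips: "measure_pmf.expectation (bernoulli_pmf q \<bind> (\<lambda>flip.
             return_pmf (insert {v, Suc n} T, B(Suc n := (if flip then - B v else B v))))) G
             = h (\<beta> v)" if v: "v \<in> {1..n}" for v
    proof -
      have "measure_pmf.expectation (bernoulli_pmf q \<bind> (\<lambda>flip.
             return_pmf (insert {v, Suc n} T, B(Suc n := (if flip then - B v else B v))))) G
           = (1 - q) * G (insert {v, Suc n} T, B(Suc n := 1 * B v))
             + q * G (insert {v, Suc n} T, B(Suc n := - 1 * B v))"
        using q_range by (subst expectation_bind_finite) auto
      then show ?thesis
        using signed_step[OF assms(1) TB v, of 1] signed_step[OF assms(1) TB v, of "-1"]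
        by (simp add: G_def h_def x_def y_def \<beta>_def \<gamma>_def)
    qed
    have "measure_pmf.expectation (K (T, B)) G =
          measure_pmf.expectation (parent_pmf w n T) (\<lambda>v. h (\<beta> v))"
      unfolding K_def using finp[OF TB] set_parent_pmf[OF assms(1) TB] flips
      by (simp, subst expectation_bind_finite) (auto intro!: expectation_cong_pmf)
    also have "\<dots> = (\<Sum>v\<in>{1..n}. weight T v / D * h (\<beta> v))"
      using set_parent_pmf[OF assms(1) TB] pmf_parent_weight[OF assms(1) TB]
      by (subst integral_measure_pmf[of "{1..n}"]) (auto simp: D_def)
    also have "\<dots> = (\<Sum>v\<in>{1..n}. (h 1 + h (-1)) / 2 * (weight T v / D)
                     + (h 1 - h (-1)) / 2 * (\<beta> v * weight T v / D))"
    proof (intro sum.cong refl)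
      fix v assume v: "v \<in> {1..n}"
      have "B 1 \<in> {-1, 1}" "B v \<in> {-1, 1}"
        using broadcast_support[OF assms(1) TB] v assms(1) by auto
      then have "\<beta> v = 1 \<or> \<beta> v = -1" by (auto simp: \<beta>_def)
      then show "weight T v / D * h (\<beta> v) = (h 1 + h (-1)) / 2 * (weight T v / D)
                     + (h 1 - h (-1)) / 2 * (\<beta> v * weight T v / D)"
        using affine_interpolation(1)[of "weight T v / D" "h 1" "h (-1)"]
          affine_interpolation(2)[of "weight T v / D" "h (-1)" "h 1"]
        by (elim disjE) (simp only: mult_1 mult_minus1 minus_divide_left)+
    qed
    also have "\<dots> = (h 1 + h (-1)) / 2 + (h 1 - h (-1)) / 2 * (x / D)"
      unfolding sum.distrib sum_distrib_left[symmetric] sum1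
      by (simp add: x_def signed_weight_def \<beta>_def sum_divide_distrib)
    also have "\<dots> = (1 + x / D) / 2 * h 1 + (1 - x / D) / 2 * h (-1)"
      by (rule affine_interpolation)
    finally show "measure_pmf.expectation (K (T, B)) G =
        (1 + signed_weight n T B / D) / 2 *
          ((1 - q) * g (signed_weight n T B + \<gamma>) (signed_size n B + 1) +
            q * g (signed_weight n T B + (\<alpha> - a)) (signed_size n B - 1)) +
        (1 - signed_weight n T B / D) / 2 *
          ((1 - q) * g (signed_weight n T B - \<gamma>) (signed_size n B - 1) +
            q * g (signed_weight n T B - (\<alpha> - a)) (signed_size n B + 1))"
      unfolding h1 hm1 unfolding x_def y_def .
  qed
  finally show ?thesis .
qed

lemma integrable_broadcast:
  fixes g :: "tree \<times> (nat \<Rightarrow> int) \<Rightarrow> real"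
  assumes "n \<ge> 1"
  shows "integrable (measure_pmf (broadcast w q n)) g"
  using finite_broadcast[of "n - 1"] assms by (intro integrable_measure_pmf_finite) simp

lemma moment_linear:
  assumes "n \<ge> 1"
  shows "moment n (\<lambda>x y. s * g x y + t * h x y) = s * moment n g + t * moment n h"
  using integrable_broadcast[OF assms] by (simp add: moment_def case_prod_unfold)

lemma moment_const: "moment n (\<lambda>x y. c) = c"
  by (simp add: moment_def case_prod_unfold)

lemma moment_mono:
  assumes "n \<ge> 1" "\<And>x y. g x y \<le> h x y"
  shows "moment n g \<le> moment n h"
  using integrable_broadcast[OF assms(1)] assms(2)
  by (simp add: moment_def case_prod_unfold integral_mono)

lemma moment_one:
  "moment 1 g = g 1 1"
proof -
  have "moment 1 g = measure_pmf.expectation (broadcast w q 1) (\<lambda>_. g 1 1)"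
    unfolding moment_def
    by (intro expectation_cong_pmf)
       (auto simp: uniform_sign_def signed_weight_def signed_size_def weight_def f_init[simplified])
  then show ?thesis by simp
qed

lemma total_weight_pos: "n \<ge> 1 \<Longrightarrow> total_weight n > 0"
  using \<gamma>_pos by (simp add: total_weight_def add_pos_nonneg)

lemma total_weight_Suc: "total_weight (Suc n) = total_weight n + \<gamma>"
  by (simp add: total_weight_def algebra_simps)

section \<open>Recursions for the first two moments\<close>

definition mean :: "nat \<Rightarrow> real" where "mean n = moment n (\<lambda>x y. x)"

text \<open>
  The expected square of the increment of the signed weight, which is \<open>\<plusminus> \<gamma>\<close> for a faithful copy and
  \<open>\<plusminus> (\<alpha> - a)\<close> for a flip.
\<close>

definition \<kappa> :: real where "\<kappa> = (1 - q) * \<gamma>\<^sup>2 + q * (\<alpha> - a)\<^sup>2"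

lemma mean_one: "mean 1 = 1"
  by (simp only: mean_def moment_one)

lemma mean_Suc:
  assumes "n \<ge> 1"
  shows "mean (Suc n) = (1 + \<rho> / total_weight n) * mean n"
proof -
  have "mean (Suc n) = moment n (\<lambda>x y. (1 + \<rho> / total_weight n) * x + 0 * x)"
    unfolding mean_def moment_Suc[OF assms]
    by (rule arg_cong[where f = "moment n"])
       (auto intro!: ext simp: \<rho>_def \<gamma>_def add_divide_distrib diff_divide_distrib algebra_simps)
  then show ?thesis by (subst (asm) moment_linear[OF assms]) (simp add: mean_def)
qed

lemma second_moment_Suc:
  assumes "n \<ge> 1"
  shows "moment (Suc n) (\<lambda>x y. x\<^sup>2) = (1 + 2 * \<rho> / total_weight n) * moment n (\<lambda>x y. x\<^sup>2) + \<kappa>"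
proof -
  have "(1 + p) / 2 * ((1 - q) * (x + \<gamma>)\<^sup>2 + q * (x + (\<alpha> - a))\<^sup>2) +
        (1 - p) / 2 * ((1 - q) * (x - \<gamma>)\<^sup>2 + q * (x - (\<alpha> - a))\<^sup>2)
      = x\<^sup>2 + \<kappa> + 2 * x * p * \<rho>" for x p :: real
  proof -
    have flip: "x + (\<alpha> - a) = x - (a - \<alpha>)" "x - (\<alpha> - a) = x + (a - \<alpha>)"
      by simp_all
    show ?thesis
      unfolding flip two_sided_square
      by (simp add: \<kappa>_def \<rho>_def \<gamma>_def power2_eq_square algebra_simps)
  qed
  then have "moment (Suc n) (\<lambda>x y. x\<^sup>2) =
        moment n (\<lambda>x y. x\<^sup>2 + \<kappa> + 2 * x * (x / total_weight n) * \<rho>)"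
    unfolding moment_Suc[OF assms] by (simp only:)
  also have "\<dots> = moment n (\<lambda>x y. (1 + 2 * \<rho> / total_weight n) * x\<^sup>2 + \<kappa> * 1)"
    by (simp add: power2_eq_square algebra_simps)
  finally have "moment (Suc n) (\<lambda>x y. x\<^sup>2) =
        moment n (\<lambda>x y. (1 + 2 * \<rho> / total_weight n) * x\<^sup>2 + \<kappa> * 1)" .
  then show ?thesis by (subst (asm) moment_linear[OF assms]) (simp add: moment_const)
qed

text \<open>
  The signed size has drift \<open>(1 - 2 * q) * W / D\<close> and the signed weight has drift \<open>\<rho> * W / D\<close>. The
  condition on \<open>\<theta>\<close> balances them, so that the difference is a martingale and its second moment
  grows by the mean square of its increments.
\<close>

lemma residual_Suc:
  assumes "n \<ge> 1" "\<theta> * \<rho> = 1 - 2 * q"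
  shows "moment (Suc n) (\<lambda>x y. (y - \<theta> * x)\<^sup>2) = moment n (\<lambda>x y. (y - \<theta> * x)\<^sup>2) +
           ((1 - q) * (1 - \<theta> * \<gamma>)\<^sup>2 + q * (1 + \<theta> * (\<alpha> - a))\<^sup>2)"
proof -
  let ?k = "(1 - q) * (1 - \<theta> * \<gamma>)\<^sup>2 + q * (1 + \<theta> * (\<alpha> - a))\<^sup>2"
  have drift: "(1 - q) * (1 - \<theta> * \<gamma>) - q * (1 + \<theta> * (\<alpha> - a)) = 0"
    using assms(2) by (simp add: \<rho>_def \<gamma>_def algebra_simps)
  have "(1 + p) / 2 * ((1 - q) * (y + 1 - \<theta> * (x + \<gamma>))\<^sup>2 + q * (y - 1 - \<theta> * (x + (\<alpha> - a)))\<^sup>2) +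
        (1 - p) / 2 * ((1 - q) * (y - 1 - \<theta> * (x - \<gamma>))\<^sup>2 + q * (y + 1 - \<theta> * (x - (\<alpha> - a)))\<^sup>2)
      = 1 * (y - \<theta> * x)\<^sup>2 + ?k * 1" for x y p
  proof -
    have shift: "y + 1 - \<theta> * (x + \<gamma>) = (y - \<theta> * x) + (1 - \<theta> * \<gamma>)"
      "y - 1 - \<theta> * (x + (\<alpha> - a)) = (y - \<theta> * x) - (1 + \<theta> * (\<alpha> - a))"
      "y - 1 - \<theta> * (x - \<gamma>) = (y - \<theta> * x) - (1 - \<theta> * \<gamma>)"
      "y + 1 - \<theta> * (x - (\<alpha> - a)) = (y - \<theta> * x) + (1 + \<theta> * (\<alpha> - a))"
      by (simp_all add: algebra_simps)
    show ?thesis unfolding shift two_sided_square drift by simp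
  qed
  then have "moment (Suc n) (\<lambda>x y. (y - \<theta> * x)\<^sup>2) =
             moment n (\<lambda>x y. 1 * (y - \<theta> * x)\<^sup>2 + ?k * 1)"
    unfolding moment_Suc[OF assms(1)] by (simp only:)
  then show ?thesis by (subst (asm) moment_linear[OF assms(1)]) (simp add: moment_const)
qed

section \<open>Chebyshev's inequality for the majority\<close>

text \<open>
  If the signed size is positive, the majority agrees with the root; a tie is counted as an error.
\<close>

lemma error_le_moment:
  assumes "N \<ge> 1"
  shows "R_maj_at w N q \<le> moment N (\<lambda>x y. if y \<le> 0 then 1 else 0)"
proof -
  let ?A = "{(b, b_maj). b_maj \<noteq> b} :: (int \<times> int) set"
  define K where "K = (\<lambda>(T :: tree, B :: nat \<Rightarrow> int). uniform_sign \<bind> (\<lambda>tie.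
       return_pmf (B 1, if (\<Sum>u\<in>{1..N}. B u) \<noteq> 0 then sgn (\<Sum>u\<in>{1..N}. B u) else tie)))"
  have fin: "finite (set_pmf (broadcast w q N))"
    using finite_broadcast[of "N - 1"] assms by simp
  have eq: "root_and_majority w q N = broadcast w q N \<bind> K"
    by (simp only: root_and_majority_def K_def Let_def)
  have "R_maj_at w N q = measure_pmf.expectation (broadcast w q N \<bind> K) (indicator ?A)"
    by (simp add: R_maj_at_def eq)
  also have "\<dots> = measure_pmf.expectation (broadcast w q N)
                    (\<lambda>x. measure_pmf.expectation (K x) (indicator ?A))"
    using fin by (intro expectation_bind_finite) (auto simp: K_def uniform_sign_def)
  also have "\<dots> \<le> moment N (\<lambda>x y. if y \<le> 0 then 1 else 0)"
    unfolding moment_def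
  proof (intro integral_mono_AE integrable_broadcast assms, unfold AE_measure_pmf_iff, clarify)
    fix T B assume TB: "(T, B) \<in> set_pmf (broadcast w q N)"
    let ?S = "\<Sum>u\<in>{1..N}. B u"
    have B1: "B 1 = -1 \<or> B 1 = 1" using broadcast_support[OF assms TB] assms by auto
    have S: "signed_size N B = real_of_int (B 1 * ?S)"
      by (simp add: signed_size_def sum_distrib_left)
    show "measure_pmf.expectation (K (T, B)) (indicat_real ?A) \<le> (if signed_size N B \<le> 0 then 1 else 0)"
    proof (cases "signed_size N B \<le> 0")
      case True
      have "measure_pmf.expectation (K (T, B)) (indicat_real ?A) = measure_pmf.prob (K (T, B)) ?A"
        by simp
      also have "\<dots> \<le> 1" by (rule measure_pmf.prob_le_1)
      finally show ?thesis using True by (simp only: if_True)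
    next
      case False
      then have "B 1 * ?S > 0" unfolding S by linarith
      then have "?S \<noteq> 0" "sgn ?S = B 1" using B1 by (auto simp: sgn_if)
      then have "K (T, B) = return_pmf (B 1, B 1)" by (simp add: K_def)
      then show ?thesis by simp
    qed
  qed
  finally show ?thesis .
qed

text \<open>
  If the size \<open>y\<close> is at most \<open>0\<close>, the deviations \<open>\<theta> * (x - m)\<close> and \<open>y - \<theta> * x\<close> sum to at most
  \<open>- \<theta> * m\<close>, where \<open>m\<close> is the mean of the weight \<open>x\<close>. So the sum of their squares is at least
  \<open>(\<theta> * m)\<^sup>2 / 2\<close>. The two right-hand terms are the relative variance of the weight and the
  contribution of the martingale.
\<close>

lemma chebyshev:
  assumes "N \<ge> 1" "\<theta> > 0" "mean N > 0"
  shows "R_maj_at w N q \<le> 2 * (moment N (\<lambda>x y. x\<^sup>2) / (mean N)\<^sup>2 - 1) +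
           2 * moment N (\<lambda>x y. (y - \<theta> * x)\<^sup>2) / (\<theta> * mean N)\<^sup>2"
proof -
  let ?m = "mean N"
  let ?s = "2 / ?m\<^sup>2" and ?t = "2 / (\<theta> * ?m)\<^sup>2"
  have dom: "(if y \<le> 0 then 1 else 0) \<le> ?s * (x - ?m)\<^sup>2 + ?t * (y - \<theta> * x)\<^sup>2" for x y
  proof (cases "y \<le> 0")
    case True
    have "(\<theta> * ?m)\<^sup>2 \<le> (\<theta> * ?m - y)\<^sup>2"
      using True assms by (intro power_mono) auto
    also have "\<dots> = (\<theta> * (x - ?m) + (y - \<theta> * x))\<^sup>2"
      by (simp add: power2_eq_square algebra_simps)
    also have "\<dots> \<le> 2 * (\<theta> * (x - ?m))\<^sup>2 + 2 * (y - \<theta> * x)\<^sup>2"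
      by (rule square_sum_le)
    finally have "1 \<le> (2 * (\<theta> * (x - ?m))\<^sup>2 + 2 * (y - \<theta> * x)\<^sup>2) / (\<theta> * ?m)\<^sup>2"
      using assms by (simp add: le_divide_eq_1_pos)
    also have "\<dots> = ?s * (x - ?m)\<^sup>2 + ?t * (y - \<theta> * x)\<^sup>2"
      using assms by (simp add: add_divide_distrib power_mult_distrib)
    finally show ?thesis using True by simp
  qed simp
  have sq: "moment N (\<lambda>x y. (x - ?m)\<^sup>2) = moment N (\<lambda>x y. x\<^sup>2) - ?m\<^sup>2"
  proof -
    have "moment N (\<lambda>x y. (x - ?m)\<^sup>2) =
          moment N (\<lambda>x y. 1 * x\<^sup>2 + 1 * ((- 2 * ?m) * x + ?m\<^sup>2 * 1))"
      by (simp add: power2_eq_square algebra_simps)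
    also have "\<dots> = 1 * moment N (\<lambda>x y. x\<^sup>2) + 1 * ((- 2 * ?m) * ?m + ?m\<^sup>2 * 1)"
      by (simp only: moment_linear[OF assms(1)] moment_const mean_def)
    finally show ?thesis by (simp add: power2_eq_square)
  qed
  have "R_maj_at w N q \<le> moment N (\<lambda>x y. ?s * (x - ?m)\<^sup>2 + ?t * (y - \<theta> * x)\<^sup>2)"
    by (rule order_trans[OF error_le_moment[OF assms(1)] moment_mono[OF assms(1) dom]])
  also have "\<dots> = ?s * (moment N (\<lambda>x y. x\<^sup>2) - ?m\<^sup>2) + ?t * moment N (\<lambda>x y. (y - \<theta> * x)\<^sup>2)"
    by (simp only: moment_linear[OF assms(1)] sq)
  also have "\<dots> = 2 * (moment N (\<lambda>x y. x\<^sup>2) / ?m\<^sup>2 - 1) +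
           2 * moment N (\<lambda>x y. (y - \<theta> * x)\<^sup>2) / (\<theta> * ?m)\<^sup>2"
    using assms by (simp add: field_simps)
  finally show ?thesis .
qed


section \<open>Asymptotics\<close>

lemma mean_pos:
  assumes "n \<ge> 1" "\<rho> > 0"
  shows "mean n > 0"
  using assms(1)
proof (induction n rule: nat_induct_at_least)
  case base
  then show ?case using mean_one by simp
next
  case (Suc n)
  have "1 + \<rho> / total_weight n > 0"
    using assms(2) total_weight_pos[OF Suc.hyps] by (simp add: add_pos_pos)
  then show ?case using Suc.IH by (simp add: mean_Suc[OF Suc.hyps])
qed

lemma total_weight_one: "total_weight 1 = 1"
  by (simp add: total_weight_def)

text \<open>
  The mean is of order \<open>D\<close> to the power \<open>\<rho> / \<gamma>\<close>. The exponent \<open>3 / 4\<close> stands for any number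
  above \<open>1 / 2\<close>, which is what makes \<open>D / m\<^sup>2\<close> vanish.
\<close>

lemma mean_growth:
  assumes "n \<ge> 1" "4 * \<rho> \<ge> 3 * \<gamma>"
  shows "total_weight n ^ 3 \<le> mean n ^ 4"
  using assms(1)
proof (induction n rule: nat_induct_at_least)
  case base
  then show ?case using mean_one total_weight_one by simp
next
  case (Suc n)
  let ?D = "total_weight n"
  have D: "?D > 0" using total_weight_pos Suc.hyps by simp
  have "total_weight (Suc n) = (1 + \<gamma> / ?D) * ?D"
    using D by (simp add: total_weight_Suc field_simps)
  then have "total_weight (Suc n) ^ 3 = (1 + \<gamma> / ?D) ^ 3 * ?D ^ 3"
    by (simp only: power_mult_distrib)
  also have "\<dots> \<le> (1 + \<rho> / ?D) ^ 4 * mean n ^ 4"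
  proof (intro mult_mono Suc.IH cube_le_fourth_power)
    show "3 / 4 * (\<gamma> / ?D) \<le> \<rho> / ?D"
      using assms(2) D by (simp add: field_simps)
  qed (use D \<gamma>_pos in auto)
  also have "\<dots> = mean (Suc n) ^ 4"
    by (simp only: mean_Suc[OF Suc.hyps] power_mult_distrib)
  finally show ?case .
qed

text \<open>
  The recursion for the second moment has the particular solution \<open>- A * D\<close>; adding \<open>A * D\<close> turns it
  into a homogeneous one with factor \<open>1 + 2 * \<rho> / D\<close>, to which \<open>ratio_step\<close> applies. The constant in
  front is the one that gives equality at \<open>n = 1\<close>.
\<close>

lemma second_moment_bound:
  assumes "n \<ge> 1" "\<rho> > 0" "2 * \<rho> > \<gamma>"
  defines "A \<equiv> \<kappa> / (2 * \<rho> - \<gamma>)" and "x \<equiv> \<rho>\<^sup>2 / \<gamma>"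
  shows "moment n (\<lambda>x y. x\<^sup>2) + A * total_weight n
           \<le> (1 + A) / (1 + x) * (1 + x / total_weight n) * (mean n)\<^sup>2"
  using assms(1)
proof (induction n rule: nat_induct_at_least)
  case base
  have "x \<ge> 0" using \<gamma>_pos by (simp add: x_def)
  then have "1 + x \<noteq> 0" by linarith
  then show ?case by (simp only: moment_one total_weight_one mean_one) simp
next
  case (Suc n)
  let ?D = "total_weight n" and ?H = "(1 + A) / (1 + x)"
  have D: "?D > 0" using total_weight_pos Suc.hyps by simp
  have x: "x \<ge> 0" using \<gamma>_pos by (simp add: x_def)
  have "\<kappa> \<ge> 0" using q_range by (simp add: \<kappa>_def)
  then have A: "A \<ge> 0" using assms(3) by (simp add: A_def)
  have H: "?H \<ge> 0" using A x by simp
  have "A * (2 * \<rho> - \<gamma>) = \<kappa>" using assms(3) by (simp add: A_def)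
  then have drift: "\<kappa> + A * \<gamma> = A * (2 * \<rho>)" by (simp add: algebra_simps)
  have "moment (Suc n) (\<lambda>x y. x\<^sup>2) + A * total_weight (Suc n) =
        (1 + 2 * \<rho> / ?D) * moment n (\<lambda>x y. x\<^sup>2) + A * ?D + (\<kappa> + A * \<gamma>)"
    by (simp add: second_moment_Suc[OF Suc.hyps] total_weight_Suc algebra_simps)
  also have "\<dots> = (1 + 2 * \<rho> / ?D) * (moment n (\<lambda>x y. x\<^sup>2) + A * ?D)"
    unfolding drift using D by (simp add: algebra_simps)
  also have "\<dots> \<le> (1 + 2 * \<rho> / ?D) * (?H * (1 + x / ?D) * (mean n)\<^sup>2)"
    using D assms(2) by (intro mult_left_mono Suc.IH) simp
  also have "\<dots> = (?H * (mean n)\<^sup>2) * ((1 + x / ?D) * (1 + 2 * \<rho> / ?D))"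
    by (simp only: mult_ac)
  also have "\<dots> \<le> (?H * (mean n)\<^sup>2) * ((1 + x / (?D + \<gamma>)) * (1 + \<rho> / ?D)\<^sup>2)"
    using ratio_step[OF \<gamma>_pos D, of \<rho>, folded x_def] H
    by (intro mult_left_mono mult_nonneg_nonneg) auto
  also have "\<dots> = ?H * (1 + x / total_weight (Suc n)) * (mean (Suc n))\<^sup>2"
    by (simp only: mean_Suc[OF Suc.hyps] total_weight_Suc power_mult_distrib mult_ac)
  finally show ?case .
qed

text \<open>
  For \<open>q = 0\<close> one has \<open>\<kappa> = \<gamma>\<^sup>2\<close> and \<open>\<rho> = \<gamma>\<close>, hence \<open>A = \<gamma> = x\<close> and the left-hand side is \<open>0\<close>.
  The assumption on \<open>q\<close> keeps the denominator of \<open>A\<close> away from \<open>0\<close>, and then \<open>A - x\<close> is at most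
  a multiple of \<open>q\<close>.
\<close>

lemma limiting_variance_bound:
  assumes "8 * a * q \<le> \<gamma>"
  defines "A \<equiv> \<kappa> / (2 * \<rho> - \<gamma>)" and "x \<equiv> \<rho>\<^sup>2 / \<gamma>"
  shows "(1 + A) / (1 + x) - 1 \<le> 8 * a * (\<bar>\<alpha>\<bar> + 2 * \<gamma>) / \<gamma> * q"
proof -
  define \<delta> where "\<delta> = 2 * a * q"
  have \<delta>: "0 \<le> \<delta>" "4 * \<delta> \<le> \<gamma>" "\<rho> = \<gamma> - \<delta>"
    using assms(1) a_pos q_range by (simp_all add: \<delta>_def \<rho>_def)
  have x: "x \<ge> 0" using \<gamma>_pos by (simp add: x_def)
  have den: "2 * \<rho> - \<gamma> \<ge> \<gamma> / 2" using \<delta> by simp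
  then have den0: "2 * \<rho> - \<gamma> > 0" using \<gamma>_pos by linarith
  let ?B = "8 * a * (\<bar>\<alpha>\<bar> + 2 * \<gamma>) / \<gamma> * q"
  have B0: "?B \<ge> 0" using a_pos \<gamma>_pos q_range by simp
  have "\<kappa> = \<gamma>\<^sup>2 - 2 * \<alpha> * \<delta>"
    by (simp add: \<kappa>_def \<gamma>_def \<delta>_def power2_eq_square algebra_simps)
  also have "\<dots> \<le> \<gamma>\<^sup>2 + 2 * \<bar>\<alpha>\<bar> * \<delta>"
    using mult_right_mono[OF abs_ge_minus_self[of \<alpha>] \<delta>(1)] by (simp add: algebra_simps)
  finally have \<kappa>: "\<gamma> * \<kappa> \<le> \<gamma> * (\<gamma>\<^sup>2 + 2 * \<bar>\<alpha>\<bar> * \<delta>)"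
    using \<gamma>_pos by simp
  have "\<rho>\<^sup>2 * (2 * \<rho> - \<gamma>) - (\<gamma> * \<gamma>\<^sup>2 - 4 * \<gamma>\<^sup>2 * \<delta>) = \<delta>\<^sup>2 * (5 * \<gamma> - 2 * \<delta>)"
    unfolding \<delta>(3) by (simp add: power2_eq_square algebra_simps)
  also have "\<dots> \<ge> 0" using \<delta> \<gamma>_pos by simp
  finally have num: "\<gamma> * \<kappa> - \<rho>\<^sup>2 * (2 * \<rho> - \<gamma>) \<le> 2 * \<gamma> * \<delta> * (\<bar>\<alpha>\<bar> + 2 * \<gamma>)"
    using \<kappa> by (simp add: power2_eq_square algebra_simps)
  have "?B * (\<gamma> * (\<gamma> / 2)) = 2 * \<gamma> * \<delta> * (\<bar>\<alpha>\<bar> + 2 * \<gamma>)"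
    using \<gamma>_pos by (simp add: \<delta>_def)
  moreover have "?B * (\<gamma> * (\<gamma> / 2)) \<le> ?B * (\<gamma> * (2 * \<rho> - \<gamma>))"
    using den B0 \<gamma>_pos by (intro mult_left_mono) auto
  ultimately have "\<gamma> * \<kappa> - \<rho>\<^sup>2 * (2 * \<rho> - \<gamma>) \<le> ?B * (\<gamma> * (2 * \<rho> - \<gamma>))"
    using num by linarith
  then have "(\<gamma> * \<kappa> - \<rho>\<^sup>2 * (2 * \<rho> - \<gamma>)) / (\<gamma> * (2 * \<rho> - \<gamma>)) \<le> ?B"
    using \<gamma>_pos den0 by (subst pos_divide_le_eq) auto
  moreover have "(\<gamma> * \<kappa> - \<rho>\<^sup>2 * (2 * \<rho> - \<gamma>)) / (\<gamma> * (2 * \<rho> - \<gamma>)) = A - x"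
    using \<gamma>_pos den0 unfolding A_def x_def by (simp add: diff_divide_distrib)
  ultimately have AB: "A - x \<le> ?B" by simp
  have "(1 + A) / (1 + x) - 1 = (A - x) / (1 + x)"
    using x by (simp add: field_simps)
  also have "\<dots> \<le> ?B / (1 + x)" using AB x by (intro divide_right_mono) auto
  also have "\<dots> \<le> ?B / 1" using B0 x by (intro divide_left_mono) auto
  finally show ?thesis by simp
qed

lemma residual_linear:
  assumes "\<theta> * \<rho> = 1 - 2 * q"
  shows "\<exists>C. \<forall>n\<ge>1. moment n (\<lambda>x y. (y - \<theta> * x)\<^sup>2) \<le> C * total_weight n"
proof -
  define k where "k = (1 - q) * (1 - \<theta> * \<gamma>)\<^sup>2 + q * (1 + \<theta> * (\<alpha> - a))\<^sup>2"
  define C where "C = max ((1 - \<theta>)\<^sup>2) (k / \<gamma>)"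
  have "k / \<gamma> * \<gamma> \<le> C * \<gamma>"
    using \<gamma>_pos unfolding C_def by (intro mult_right_mono) auto
  then have k: "k \<le> C * \<gamma>" using \<gamma>_pos by simp
  have "moment n (\<lambda>x y. (y - \<theta> * x)\<^sup>2) \<le> C * total_weight n" if "n \<ge> 1" for n
    using that
  proof (induction n rule: nat_induct_at_least)
    case base
    then show ?case by (simp only: moment_one total_weight_one) (simp add: C_def)
  next
    case (Suc n)
    then show ?case using k
      by (simp add: residual_Suc[OF Suc.hyps assms] total_weight_Suc distrib_left flip: k_def)
  qed
  then show ?thesis by blast
qed

lemma total_weight_at_top: "filterlim total_weight at_top sequentially"
proof -
  have "filterlim (\<lambda>n. 1 + \<gamma> * (real n - 1)) at_top sequentially"
    using \<gamma>_pos by real_asymp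
  then show ?thesis unfolding total_weight_def[abs_def] .
qed

text \<open>
  The Chebyshev bound converges: the martingale term is of order \<open>D / m\<^sup>2 \<le> 1 / sqrt D\<close> and
  vanishes, and only twice the limiting relative variance remains.
\<close>

lemma R_maj_le_linear:
  assumes "q \<le> 1 / 4" "8 * a * q \<le> \<gamma>"
  shows "R_maj w q \<le> ereal (16 * a * (\<bar>\<alpha>\<bar> + 2 * \<gamma>) / \<gamma> * q)"
proof -
  define A where "A = \<kappa> / (2 * \<rho> - \<gamma>)"
  define x where "x = \<rho>\<^sup>2 / \<gamma>"
  define H where "H = (1 + A) / (1 + x)"
  define \<theta> where "\<theta> = (1 - 2 * q) / \<rho>"
  have \<rho>: "4 * \<rho> \<ge> 3 * \<gamma>" using assms(2) by (simp add: \<rho>_def)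
  then have \<rho>0: "\<rho> > 0" "2 * \<rho> > \<gamma>" using \<gamma>_pos by linarith+
  have \<theta>: "\<theta> > 0" "\<theta> * \<rho> = 1 - 2 * q"
    using assms(1) \<rho>0 by (auto simp: \<theta>_def)
  obtain C where C: "\<And>n. n \<ge> 1 \<Longrightarrow> moment n (\<lambda>x y. (y - \<theta> * x)\<^sup>2) \<le> C * total_weight n"
    using residual_linear[OF \<theta>(2)] by auto
  have "\<kappa> \<ge> 0" using q_range by (simp add: \<kappa>_def)
  then have A: "A \<ge> 0" using \<rho>0 by (simp add: A_def)
  define b where "b = (\<lambda>N. 2 * (H * (1 + x / total_weight N) - 1) +
                           2 * \<bar>C\<bar> / \<theta>\<^sup>2 * (1 / sqrt (total_weight N)))"
  have bound: "R_maj_at w N q \<le> b N" if N: "N \<ge> 1" for N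
  proof -
    let ?D = "total_weight N" and ?m = "mean N"
    have D: "?D > 0" using total_weight_pos[OF N] .
    have m: "?m > 0" using mean_pos[OF N \<rho>0(1)] .
    have "moment N (\<lambda>x y. x\<^sup>2) \<le> H * (1 + x / ?D) * ?m\<^sup>2"
      using second_moment_bound[OF N \<rho>0] mult_nonneg_nonneg[OF A less_imp_le[OF D]]
      unfolding A_def H_def x_def by linarith
    then have first: "moment N (\<lambda>x y. x\<^sup>2) / ?m\<^sup>2 \<le> H * (1 + x / ?D)"
      using m by (simp add: pos_divide_le_eq)
    have "(?D * sqrt ?D)\<^sup>2 \<le> (?m\<^sup>2)\<^sup>2"
    proof -
      have "(?D * sqrt ?D)\<^sup>2 = ?D ^ 3"
        using D by (simp add: power_mult_distrib power3_eq_cube power2_eq_square)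
      moreover have "(?m\<^sup>2)\<^sup>2 = ?m ^ 4" by (simp flip: power_mult)
      ultimately show ?thesis using mean_growth[OF N \<rho>] by simp
    qed
    then have growth: "?D * sqrt ?D \<le> ?m\<^sup>2"
      by (rule power2_le_imp_le) simp
    have "moment N (\<lambda>x y. (y - \<theta> * x)\<^sup>2) \<le> \<bar>C\<bar> * ?D"
      using C[OF N] mult_right_mono[OF abs_ge_self[of C] less_imp_le[OF D]] by linarith
    also have "\<dots> = \<bar>C\<bar> / sqrt ?D * (?D * sqrt ?D)" using D by simp
    also have "\<dots> \<le> \<bar>C\<bar> / sqrt ?D * ?m\<^sup>2"
      using growth D by (intro mult_left_mono) auto
    finally have "moment N (\<lambda>x y. (y - \<theta> * x)\<^sup>2) / ?m\<^sup>2 \<le> \<bar>C\<bar> / sqrt ?D"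
      using m by (simp add: pos_divide_le_eq)
    then have "2 / \<theta>\<^sup>2 * (moment N (\<lambda>x y. (y - \<theta> * x)\<^sup>2) / ?m\<^sup>2) \<le> 2 / \<theta>\<^sup>2 * (\<bar>C\<bar> / sqrt ?D)"
      by (intro mult_left_mono) auto
    then show ?thesis
      using chebyshev[OF N \<theta>(1) m] first by (simp add: b_def power_mult_distrib)
  qed
  have inv: "((\<lambda>N. x / total_weight N) \<longlongrightarrow> 0) sequentially"
    using total_weight_at_top
    by (intro tendsto_divide_0[OF tendsto_const] filterlim_at_top_imp_at_infinity)
  have inv_sqrt: "((\<lambda>N. 1 / sqrt (total_weight N)) \<longlongrightarrow> 0) sequentially"
    by (intro tendsto_divide_0[OF tendsto_const] filterlim_at_top_imp_at_infinity
        filterlim_compose[OF sqrt_at_top total_weight_at_top])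
  have "b \<longlonglongrightarrow> 2 * (H * (1 + 0) - 1) + 2 * \<bar>C\<bar> / \<theta>\<^sup>2 * 0"
    unfolding b_def by (intro tendsto_intros inv inv_sqrt)
  then have b: "b \<longlonglongrightarrow> 2 * (H - 1)" by simp
  have "R_maj w q \<le> limsup (\<lambda>N. ereal (b N))"
    unfolding R_maj_def
    by (intro Limsup_mono eventually_sequentiallyI[of 1]) (simp add: bound)
  also have "\<dots> = ereal (2 * (H - 1))"
    using b by (intro lim_imp_Limsup) auto
  also have "\<dots> \<le> ereal (16 * a * (\<bar>\<alpha>\<bar> + 2 * \<gamma>) / \<gamma> * q)"
  proof -
    have "H - 1 \<le> 8 * a * (\<bar>\<alpha>\<bar> + 2 * \<gamma>) / \<gamma> * q"
      using limiting_variance_bound[OF assms(2)] by (simp only: H_def A_def x_def)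
    then have "2 * (H - 1) \<le> 2 * (8 * a * (\<bar>\<alpha>\<bar> + 2 * \<gamma>) / \<gamma> * q)"
      by (rule mult_left_mono) simp
    also have "\<dots> = 16 * a * (\<bar>\<alpha>\<bar> + 2 * \<gamma>) / \<gamma> * q" by simp
    finally show ?thesis by (simp only: ereal_less_eq)
  qed
  finally show ?thesis .
qed


end

section \<open>The two models\<close>

lemma R_maj_le_one: "R_maj w q \<le> 1"
  unfolding R_maj_def by (intro Limsup_bounded always_eventually) (auto simp: R_maj_at_def)

text \<open>
  The threshold \<open>q0\<close> separates the range of the linear bound from the range where the summand
  \<open>1 / sqrt q0\<close> alone pushes the right-hand side above \<open>1\<close>.
\<close>

lemma R_maj_le_sqrt:
  assumes "\<And>q. q \<in> {0..1} \<Longrightarrow> linear_attachment w \<alpha> f e q"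
  shows "\<exists>c>0. \<forall>q\<in>{0..1}. R_maj w q \<le> ereal (c * sqrt q)"
proof -
  define a where "a = 1 + \<alpha> * real e"
  define \<gamma> where "\<gamma> = \<alpha> + a"
  define K where "K = 16 * a * (\<bar>\<alpha>\<bar> + 2 * \<gamma>) / \<gamma>"
  define q0 where "q0 = min (1 / 4) (\<gamma> / (8 * a))"
  have pos: "a > 0" "\<gamma> > 0"
    using linear_attachment.leaf_weight_pos[OF assms, of 0]
      linear_attachment.growth_pos[OF assms, of 0] by (auto simp: a_def \<gamma>_def)
  then have q0: "q0 > 0" by (simp add: q0_def)
  have K: "K \<ge> 0" using pos by (simp add: K_def)
  have "R_maj w q \<le> ereal ((K + 1 / sqrt q0) * sqrt q)" if q: "q \<in> {0..1}" for q
  proof (cases "q \<le> q0")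
    case True
    interpret L: linear_attachment w \<alpha> f e q using assms[OF q] .
    have eq: "L.a = a" "L.\<gamma> = \<gamma>"
      by (simp_all add: a_def \<gamma>_def L.a_def L.\<gamma>_def)
    have "q \<le> 1 / 4" "8 * a * q \<le> \<gamma>"
      using True pos by (auto simp: q0_def field_simps)
    then have "R_maj w q \<le> ereal (K * q)"
      using L.R_maj_le_linear by (simp add: K_def eq)
    moreover have "q \<le> sqrt q"
      using q by (intro real_le_rsqrt) (auto simp: power2_eq_square mult_left_le)
    then have "K * q \<le> (K + 1 / sqrt q0) * sqrt q"
      using K q0 q by (intro mult_mono) auto
    ultimately show ?thesis by (meson ereal_less_eq(3) order_trans)
  next
    case False
    then have "1 \<le> 1 / sqrt q0 * sqrt q" using q0 by simp
    also have "\<dots> \<le> (K + 1 / sqrt q0) * sqrt q" using K q by (intro mult_right_mono) auto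
    finally have "1 \<le> ereal ((K + 1 / sqrt q0) * sqrt q)" by (simp add: one_ereal_def)
    then show ?thesis using R_maj_le_one by (rule order_trans[rotated])
  qed
  moreover have "K + 1 / sqrt q0 > 0" using K q0 by (simp add: add_nonneg_pos)
  ultimately show ?thesis by blast
qed

text \<open>
  With \<open>k = 1\<close> for very simple and \<open>k = 2\<close> for shape exchangeable trees, this is the positive growth
  of the total weight.
\<close>

lemma param_lower_bound:
  assumes "\<alpha> \<in> {- 1 / real d | d :: nat. d > k} \<union> {0..}"
  shows "1 + real k * \<alpha> > 0"
  using assms
proof
  assume "\<alpha> \<in> {- 1 / real d | d :: nat. d > k}"
  then obtain d where d: "\<alpha> = - 1 / real d" "d > k" by auto
  then have "real k / real d < 1" by (subst divide_less_eq_1_pos) auto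
  then show ?thesis unfolding d(1) by simp
next
  assume "\<alpha> \<in> {0..}"
  then show ?thesis by (simp add: add_pos_nonneg)
qed

theorem theorem2p2:
  shows "(\<forall>\<alpha>\<in>very_simple_params. \<exists>c>0. \<forall>q\<in>{0..1}.
            R_maj (very_simple \<alpha>) q \<le> ereal (c * sqrt q)) \<and>
         (\<forall>\<alpha>\<in>shape_exchangeable_params. \<exists>c>0. \<forall>q\<in>{0..1}.
            R_maj (shape_exchangeable \<alpha>) q \<le> ereal (c * sqrt q))"
proof (intro conjI ballI)
  fix \<alpha> assume \<alpha>: "\<alpha> \<in> very_simple_params"
  have pos: "1 + \<alpha> > 0"
    using param_lower_bound[of \<alpha> 1] \<alpha> by (simp add: very_simple_params_def)
  have "linear_attachment (very_simple \<alpha>) \<alpha> outdeg 0 q" if q: "q \<in> {0..1}" for q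
  proof
    fix n T B v
    assume "n \<ge> 1" "(T, B) \<in> set_pmf (broadcast (very_simple \<alpha>) q n)"
    from pmf_parent_very_simple[OF \<alpha> this]
    show "pmf (parent_pmf (very_simple \<alpha>) n T) v =
            (if v \<in> {1..n}
             then (\<alpha> * real (outdeg T v) + 1) / (1 + (\<alpha> + (1 + \<alpha> * real 0)) * (real n - 1)) else 0)"
      by (simp add: very_simple_def algebra_simps)
  qed (use q pos deg_outdeg_step in \<open>auto simp: outdeg_def\<close>)
  then show "\<exists>c>0. \<forall>q\<in>{0..1}. R_maj (very_simple \<alpha>) q \<le> ereal (c * sqrt q)"
    by (rule R_maj_le_sqrt)
next
  fix \<alpha> assume \<alpha>: "\<alpha> \<in> shape_exchangeable_params"
  have "1 + 2 * \<alpha> > 0"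
    using param_lower_bound[of \<alpha> 2] \<alpha> by (simp add: shape_exchangeable_params_def)
  then have pos: "1 + \<alpha> > 0" "1 + 2 * \<alpha> > 0" by linarith+
  have "linear_attachment (shape_exchangeable \<alpha>) \<alpha> deg 1 q" if q: "q \<in> {0..1}" for q
  proof
    fix n T B v
    assume "n \<ge> 1" "(T, B) \<in> set_pmf (broadcast (shape_exchangeable \<alpha>) q n)"
    from pmf_parent_shape_exchangeable[OF \<alpha> this]
    show "pmf (parent_pmf (shape_exchangeable \<alpha>) n T) v =
            (if v \<in> {1..n}
             then (\<alpha> * real (deg T v) + 1) / (1 + (\<alpha> + (1 + \<alpha> * real 1)) * (real n - 1)) else 0)"
      by (simp add: shape_exchangeable_def algebra_simps)
  qed (use q pos deg_outdeg_step in \<open>auto simp: deg_def\<close>)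
  then show "\<exists>c>0. \<forall>q\<in>{0..1}. R_maj (shape_exchangeable \<alpha>) q \<le> ereal (c * sqrt q)"
    by (rule R_maj_le_sqrt)
qed

end
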